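(* Let $(K,d)$ be a nonempty compact metric space and let $f:K\to K$ be Ruelle-expanding. Suppose that $K$ is a basic component, that is: $f(K)=K$; $K=\overline{\mathrm{Per}(f)}$; and for any open nonempty subset $V$ of $K$ there is $N\in\mathbb N$ such that $f^N(V)=K$. Then $$h(f)=\lim_{n\to+\infty}\frac1n\log N_n(f)$$ (in particular the limit exists).
   Context: A continuous map $f:K\to K$ of a compact metric space $(K,d)$ is Ruelle-expanding if there are $r>0$, $0<\lambda<1$ and $c>0$ such that: (i) for all $x,y\in K$, if $x\neq y$ and $f(x)=f(y)$ then $d(x,y)>c$; (ii) for every $x\in K$ and every $a\in f^{-1}(\{x\})$ there is a map $\phi:B_r(x)\to K$ (with $B_r(x)$ the open ball of radius $r$ centered at $x$) such that $\phi(x)=a$, $f(\phi(y))=y$ for all $y\in B_r(x)$, and $d(\phi(y),\phi(z))\le\lambda d(y,z)$ for all $y,z\in B_r(x)$. $\mathrm{Per}(f)$ is the set of periodic points of $f$. For $n\in\mathbb N=\{1,2,\dots\}$, $N_n(f)$ is the number of points $x\in K$ with $f^n(x)=x$ (finite for Ruelle-expanding maps). Topological entropy: put $d_n(x,y)=\max_{0\le i\le n-1}d(f^i(x),f^i(y))$. A set $E\subseteq K$ is $(n,\varepsilon)$-separated if for $x,y\in E$, $d_n(x,y)\le\varepsilon$ implies $x=y$; $s_n(\varepsilon,K)$ is the largest cardinality of an $(n,\varepsilon)$-separated set. Then $h(f)=\lim_{\varepsilon\to0}\limsup_{n\to\infty}\frac1n\log s_n(\varepsilon,K)$. *)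

theory Defs
  imports "HOL-Analysis.Analysis"
begin

text \<open>
  The compact metric space is a compact set \<open>K\<close> in a metric-space type, and the dynamics is
  the restriction to \<open>K\<close> of a total function \<open>f\<close>. Balls and open sets are accordingly taken
  relative to \<open>K\<close>.
\<close>

definition ruelle_expanding :: "'a::metric_space set \<Rightarrow> ('a \<Rightarrow> 'a) \<Rightarrow> bool" where
  "ruelle_expanding K f \<longleftrightarrow>
     compact K \<and> f \<in> K \<rightarrow> K \<and> continuous_on K f \<and>
     (\<exists>r \<mu> c. 0 < r \<and> 0 < \<mu> \<and> \<mu> < 1 \<and> 0 < c \<and>
       (\<forall>x\<in>K. \<forall>y\<in>K. x \<noteq> y \<and> f x = f y \<longrightarrow> dist x y > c) \<and>
       (\<forall>x\<in>K. \<forall>a\<in>K. f a = x \<longrightarrow>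
         (\<exists>\<phi>. \<phi> \<in> ball x r \<inter> K \<rightarrow> K \<and> \<phi> x = a \<and>
           (\<forall>y\<in>ball x r \<inter> K. f (\<phi> y) = y) \<and>
           (\<forall>y\<in>ball x r \<inter> K. \<forall>z\<in>ball x r \<inter> K. dist (\<phi> y) (\<phi> z) \<le> \<mu> * dist y z))))"

definition Per :: "'a set \<Rightarrow> ('a \<Rightarrow> 'a) \<Rightarrow> 'a set" where
  "Per K f = {x\<in>K. \<exists>n\<ge>1. (f ^^ n) x = x}"

definition num_periodic :: "'a set \<Rightarrow> ('a \<Rightarrow> 'a) \<Rightarrow> nat \<Rightarrow> nat" where
  "num_periodic K f n = card {x\<in>K. (f ^^ n) x = x}"

text \<open>Only meaningful for \<open>n \<ge> 1\<close>.\<close>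
definition bowen_dist :: "('a::metric_space \<Rightarrow> 'a) \<Rightarrow> nat \<Rightarrow> 'a \<Rightarrow> 'a \<Rightarrow> real" where
  "bowen_dist f n x y = Max ((\<lambda>i. dist ((f ^^ i) x) ((f ^^ i) y)) ` {..<n})"

definition separated_set ::
    "'a::metric_space set \<Rightarrow> ('a \<Rightarrow> 'a) \<Rightarrow> nat \<Rightarrow> real \<Rightarrow> 'a set \<Rightarrow> bool" where
  "separated_set K f n \<epsilon> E \<longleftrightarrow>
     E \<subseteq> K \<and> (\<forall>x\<in>E. \<forall>y\<in>E. bowen_dist f n x y \<le> \<epsilon> \<longrightarrow> x = y)"

text \<open>
  For compact \<open>K\<close>, continuous \<open>f\<close>, \<open>n \<ge> 1\<close> and \<open>\<epsilon> > 0\<close> the separated sets are finite and of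
  bounded cardinality, so this maximum exists.
\<close>
definition max_separated ::
    "'a::metric_space set \<Rightarrow> ('a \<Rightarrow> 'a) \<Rightarrow> nat \<Rightarrow> real \<Rightarrow> nat" where
  "max_separated K f n \<epsilon> = Max {card E | E. separated_set K f n \<epsilon> E}"

text \<open>
  Logarithm of a cardinality with the convention \<open>log 0 = -\<infinity>\<close>; the real logarithm of the
  library satisfies \<open>ln 0 = 0\<close>, which would be indistinguishable from \<open>log 1\<close>.
\<close>
definition log_card :: "nat \<Rightarrow> ereal" where
  "log_card m = (if m = 0 then -\<infinity> else ereal (ln (real m)))"

definition topological_entropy :: "'a::metric_space set \<Rightarrow> ('a \<Rightarrow> 'a) \<Rightarrow> ereal" where
  "topological_entropy K f =
     Lim (at_right (0::real))
       (\<lambda>\<epsilon>. limsup (\<lambda>n. log_card (max_separated K f n \<epsilon>) / ereal (real n)))"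

definition basic_component :: "'a::metric_space set \<Rightarrow> ('a \<Rightarrow> 'a) \<Rightarrow> bool" where
  "basic_component K f \<longleftrightarrow>
     f ` K = K \<and> K = closure (Per K f) \<and>
     (\<forall>V. openin (top_of_set K) V \<and> V \<noteq> {} \<longrightarrow> (\<exists>N\<ge>1. (f ^^ N) ` V = K))"

end

theory Submission
  imports Defs
begin

text \<open>
  Write \<open>Fix n\<close> for the set of points of \<open>K\<close> with \<open>f\<^sup>n x = x\<close>, and \<open>N\<^sub>n\<close> for its
  cardinality. Two properties of \<open>f\<close> tie these numbers to the separated sets that define the
  entropy.

  Expansion: let \<open>\<eta>\<close> be \<open>expansivity_const\<close> and \<open>n \<ge> 1\<close>. Two points of \<open>Fix n\<close> whose orbits stay
  \<open>\<eta>\<close>-close for \<open>n\<close> steps coincide, because following the two closed orbits once around backwards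
  contracts their distance by the factor \<open>\<mu>\<^sup>n\<close> (lemma \<open>periodic_points_expansive\<close>). Hence \<open>Fix n\<close> is finite and, for
  \<open>\<epsilon> \<le> \<eta>\<close>, it is \<open>(n, \<epsilon>)\<close>-separated.

  Shadowing: for every \<open>\<epsilon> > 0\<close> there is a single \<open>M\<close> such that the first \<open>n\<close> steps of any orbit are
  \<open>\<epsilon>\<close>-shadowed by a point of \<open>Fix (n + M)\<close>, for every \<open>n\<close> (lemma \<open>periodic_shadowing\<close>). By
  compactness some \<open>f\<^sup>M\<close> maps every small ball onto \<open>K\<close>, so the orbit segment can be closed up to
  a pseudo-orbit from \<open>x\<close> to \<open>x\<close>; the inverse branch of \<open>f\<^bsup>n + M\<^esup>\<close> along it is a contraction of a
  ball around \<open>x\<close>, and its fixed point is the periodic point.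

  Together they give \<open>N\<^sub>n \<le> s\<^sub>n(\<epsilon>) \<le> N\<^bsub>n + M\<^esub>\<close> for all \<open>\<epsilon> \<le> \<eta>\<close>, so that the growth rate of \<open>s\<^sub>n(\<epsilon>)\<close>
  does not depend on \<open>\<epsilon>\<close> and is the one of \<open>N\<^sub>n\<close>, provided that the latter exists. It does:
  shadowing the two pieces of a periodic orbit of length \<open>n + m\<close> separately gives
  \<open>N\<^bsub>n + m\<^esub> \<le> N\<^bsub>n + M\<^esub> N\<^bsub>m + M\<^esub>\<close>, and Fekete's argument for subadditive sequences applies up to a
  bounded error.
\<close>

section \<open>Almost subadditive sequences\<close>

lemma subadditive_multiples:
  fixes u :: "nat \<Rightarrow> real"
  assumes "\<And>n m. n \<ge> k \<Longrightarrow> m \<ge> k \<Longrightarrow> u (n + m) \<le> u n + u m"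
    and "m \<ge> k" "r \<ge> k"
  shows "u (q * m + r) \<le> real q * u m + u r"
proof (induction q)
  case (Suc q)
  have "u (Suc q * m + r) = u (m + (q * m + r))" by (simp add: algebra_simps)
  also have "\<dots> \<le> u m + u (q * m + r)" using assms(2,3) by (intro assms(1)) auto
  also have "\<dots> \<le> real (Suc q) * u m + u r" using Suc by (simp add: algebra_simps)
  finally show ?case .
qed simp

text \<open>
  Fekete's lemma: dividing \<open>n\<close> by a fixed \<open>m\<close> shows that \<open>u n / n\<close> is eventually at most
  \<open>u m / m\<close> up to an arbitrarily small error, so the sequence converges to the infimum
  of these quotients over \<open>m \<ge> k\<close>. The remainder of the division is taken in \<open>{k..<k + m}\<close>,
  where subadditivity is available.
\<close>
lemma fekete_from:
  fixes u :: "nat \<Rightarrow> real"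
  assumes sub: "\<And>n m. n \<ge> k \<Longrightarrow> m \<ge> k \<Longrightarrow> u (n + m) \<le> u n + u m"
    and nonneg: "\<And>n. u n \<ge> 0" and k: "k \<ge> 1"
  shows "convergent (\<lambda>n. u n / real n)"
proof -
  define A where "A = (\<lambda>m. u m / real m) ` {k..}"
  define L where "L = Inf A"
  have bdd: "bdd_below A" unfolding A_def by (rule bdd_belowI[of _ 0]) (auto simp: nonneg)
  have lower: "L \<le> u n / real n" if "n \<ge> k" for n
    unfolding L_def by (rule cInf_lower[OF _ bdd]) (use that in \<open>auto simp: A_def\<close>)
  have "(\<lambda>n. u n / real n) \<longlonglongrightarrow> L"
  proof (rule LIMSEQ_I)
    fix e :: real assume e: "e > 0"
    have "Inf A < L + e / 2" using e by (simp add: L_def)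
    moreover have "A \<noteq> {}" by (auto simp: A_def)
    ultimately obtain m where m: "m \<ge> k" "u m / real m < L + e / 2"
      using cInf_lessD[of A] unfolding A_def by auto
    have m0: "m > 0" using m(1) k by linarith
    define B where "B = Max (u ` {k..<k + m})"
    have upper: "u n / real n \<le> u m / real m + B / real n" if n: "n \<ge> k" for n
    proof -
      define q r where "q = (n - k) div m" and "r = k + (n - k) mod m"
      have nqr: "n = q * m + r" using n by (simp add: q_def r_def)
      have r: "r \<in> {k..<k + m}" using m0 by (simp add: r_def)
      have n0: "n > 0" using n k by linarith
      have "u n \<le> real q * u m + u r"
        unfolding nqr using sub m(1) r by (intro subadditive_multiples[of k]) auto
      moreover have "u r \<le> B" unfolding B_def using r by (intro Max_ge) auto
      moreover have "real q * u m \<le> real n * (u m / real m)"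
      proof -
        have "real q * real m \<le> real n" by (simp add: nqr)
        hence "(real q * real m) * (u m / real m) \<le> real n * (u m / real m)"
          by (rule mult_right_mono) (simp add: nonneg)
        thus ?thesis using m0 by simp
      qed
      ultimately have "u n \<le> real n * (u m / real m) + B" by linarith
      hence "u n / real n \<le> (real n * (u m / real m) + B) / real n"
        by (rule divide_right_mono) simp
      also have "\<dots> = u m / real m + B / real n" using n0 by (simp add: add_divide_distrib)
      finally show ?thesis .
    qed
    have "(\<lambda>n. B / real n) \<longlonglongrightarrow> 0" by (rule lim_const_over_n)
    hence "eventually (\<lambda>n. B / real n < e / 2) sequentially"
      by (rule order_tendstoD) (use e in simp)
    then obtain n1 where n1: "\<And>n. n \<ge> n1 \<Longrightarrow> B / real n < e / 2"
      by (auto simp: eventually_sequentially)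
    show "\<exists>n0. \<forall>n\<ge>n0. norm (u n / real n - L) < e"
    proof (intro exI allI impI)
      fix n assume "n \<ge> max k n1"
      hence "n \<ge> k" "n \<ge> n1" by auto
      from upper[OF this(1)] lower[OF this(1)] n1[OF this(2)] m(2)
      have "u n / real n < L + e" "L - e < u n / real n" using e by linarith+
      thus "norm (u n / real n - L) < e" by (simp add: abs_less_iff)
    qed
  qed
  thus ?thesis by (rule convergentI)
qed

text \<open>
  Subadditivity with shifted indices is, for large indices, subadditivity up to a constant:
  the shifts are absorbed by splitting \<open>n + m\<close> as \<open>(n - M) + (m + M)\<close>, and then
  \<open>m + 2M\<close> as \<open>(m - M) + 3M\<close>.
\<close>
lemma fekete_shifted:
  fixes a :: "nat \<Rightarrow> real"
  assumes sub: "\<And>n m. n \<ge> 1 \<Longrightarrow> m \<ge> 1 \<Longrightarrow> a (n + m) \<le> a (n + M) + a (m + M)"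
    and nonneg: "\<And>n. a n \<ge> 0" and M: "M \<ge> 1"
  shows "convergent (\<lambda>n. a n / real n)"
proof -
  define C where "C = a (4 * M)"
  have "a (n + m) + C \<le> (a n + C) + (a m + C)" if n: "n \<ge> M + 1" and m: "m \<ge> M + 1" for n m
  proof -
    have "a (n + m) \<le> a n + a (m + 2 * M)"
      using sub[of "n - M" "m + M"] n m by (simp add: mult_2 add.assoc)
    moreover have "a (m + 2 * M) \<le> a m + C"
    proof -
      have "m - M + 3 * M = m + 2 * M" "m - M + M = m" "3 * M + M = 4 * M" using m by auto
      with sub[of "m - M" "3 * M"] m M show ?thesis by (simp add: C_def)
    qed
    ultimately show ?thesis by simp
  qed
  hence "convergent (\<lambda>n. (a n + C) / real n)"
    by (rule fekete_from[where k = "M + 1"]) (use nonneg in \<open>auto simp: C_def\<close>)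
  hence "convergent (\<lambda>n. (a n + C) / real n - C / real n)"
    by (rule convergent_diff) (auto intro: convergentI lim_const_over_n)
  thus ?thesis by (simp add: diff_divide_distrib[symmetric])
qed

lemma tendsto_shifted_rate:
  fixes a :: "nat \<Rightarrow> real"
  assumes "(\<lambda>n. a n / real n) \<longlonglongrightarrow> L"
  shows "(\<lambda>n. a (n + M) / real n) \<longlonglongrightarrow> L"
proof -
  have "(\<lambda>n. 1 + real M / real n) \<longlonglongrightarrow> 1 + 0"
    by (intro tendsto_intros lim_const_over_n)
  moreover have "(\<lambda>n. a (n + M) / real (n + M)) \<longlonglongrightarrow> L"
    by (rule LIMSEQ_ignore_initial_segment[OF assms])
  ultimately have "(\<lambda>n. a (n + M) / real (n + M) * (1 + real M / real n)) \<longlonglongrightarrow> L * (1 + 0)"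
    by (intro tendsto_mult)
  moreover have "eventually (\<lambda>n. a (n + M) / real (n + M) * (1 + real M / real n)
      = a (n + M) / real n) sequentially"
    using eventually_gt_at_top[of 0]
  proof eventually_elim
    case (elim n)
    hence "1 + real M / real n = real (n + M) / real n" by (simp add: field_simps)
    thus ?case using elim by simp
  qed
  ultimately show ?thesis by (simp add: tendsto_cong)
qed

section \<open>Inverse branches and expansion\<close>

definition Fix :: "'a set \<Rightarrow> ('a \<Rightarrow> 'a) \<Rightarrow> nat \<Rightarrow> 'a set" where
  "Fix K f n = {x \<in> K. (f ^^ n) x = x}"

locale expanding_map =
  fixes K :: "'a::metric_space set" and f :: "'a \<Rightarrow> 'a" and r \<mu> c :: real
  assumes compact: "compact K"
    and invariant: "x \<in> K \<Longrightarrow> f x \<in> K"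
    and continuous: "continuous_on K f"
    and r: "0 < r" and \<mu>: "0 < \<mu>" "\<mu> < 1" and c: "0 < c"
    and fibre_gap: "x \<in> K \<Longrightarrow> y \<in> K \<Longrightarrow> x \<noteq> y \<Longrightarrow> f x = f y \<Longrightarrow> dist x y > c"
    and branch: "a \<in> K \<Longrightarrow> \<exists>\<phi>. \<phi> \<in> ball (f a) r \<inter> K \<rightarrow> K \<and> \<phi> (f a) = a \<and>
           (\<forall>y\<in>ball (f a) r \<inter> K. f (\<phi> y) = y) \<and>
           (\<forall>y\<in>ball (f a) r \<inter> K. \<forall>z\<in>ball (f a) r \<inter> K. dist (\<phi> y) (\<phi> z) \<le> \<mu> * dist y z)"
begin

lemma iterate_invariant: "x \<in> K \<Longrightarrow> (f ^^ n) x \<in> K"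
  by (induction n) (auto intro: invariant)

lemma continuous_on_iterate: "continuous_on K (f ^^ n)"
proof (induction n)
  case (Suc n)
  have "(f ^^ n) ` K \<subseteq> K" using iterate_invariant by auto
  from continuous_on_compose2[OF continuous Suc this] show ?case by (simp add: comp_def)
qed simp

text \<open>
  Inverse branches compose, since each one contracts and so maps the ball of radius \<open>r\<close> around a
  point of an orbit into the ball of radius \<open>r\<close> around the preceding point.
\<close>
lemma iterated_inverse_branch:
  assumes "w \<in> K" "(f ^^ m) w = x"
  shows "\<exists>g. (\<forall>y\<in>ball x r \<inter> K. g y \<in> K \<and> (f ^^ m) (g y) = y) \<and> g x = w \<and>
    (\<forall>y\<in>ball x r \<inter> K. \<forall>z\<in>ball x r \<inter> K. dist (g y) (g z) \<le> \<mu> ^ m * dist y z \<and>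
        (\<forall>i\<le>m. dist ((f ^^ i) (g y)) ((f ^^ i) (g z)) \<le> dist y z))"
  using assms
proof (induction m arbitrary: w)
  case 0
  show ?case by (rule exI[of _ "\<lambda>y. y"]) (use 0 in auto)
next
  case (Suc m)
  have "(f ^^ m) (f w) = x" using Suc.prems(2) by (simp add: funpow_swap1)
  from Suc.IH[OF invariant[OF Suc.prems(1)] this] obtain g where
    g: "\<forall>y\<in>ball x r \<inter> K. g y \<in> K \<and> (f ^^ m) (g y) = y" "g x = f w"
    and g_dist: "\<forall>y\<in>ball x r \<inter> K. \<forall>z\<in>ball x r \<inter> K. dist (g y) (g z) \<le> \<mu> ^ m * dist y z \<and>
        (\<forall>i\<le>m. dist ((f ^^ i) (g y)) ((f ^^ i) (g z)) \<le> dist y z)"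
    by (elim exE conjE) (rule that)
  have g': "dist (g y) (g z) \<le> \<mu> ^ m * dist y z"
    "i \<le> m \<Longrightarrow> dist ((f ^^ i) (g y)) ((f ^^ i) (g z)) \<le> dist y z"
    if "y \<in> ball x r \<inter> K" "z \<in> ball x r \<inter> K" for y z i
    using g_dist that by blast+
  from branch[OF Suc.prems(1), unfolded Pi_iff] obtain \<phi> where
    \<phi>: "\<And>y. y \<in> ball (f w) r \<inter> K \<Longrightarrow> \<phi> y \<in> K" "\<phi> (f w) = w"
      "\<And>y. y \<in> ball (f w) r \<inter> K \<Longrightarrow> f (\<phi> y) = y"
      "\<And>y z. y \<in> ball (f w) r \<inter> K \<Longrightarrow> z \<in> ball (f w) r \<inter> K \<Longrightarrow> dist (\<phi> y) (\<phi> z) \<le> \<mu> * dist y z"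
    by metis
  have "x \<in> ball x r \<inter> K"
    using iterate_invariant[OF Suc.prems(1), of "Suc m"] Suc.prems(2) r by simp
  hence g_ball: "g y \<in> ball (f w) r \<inter> K" if y: "y \<in> ball x r \<inter> K" for y
    using g'(2)[of x y 0] g y by auto
  show ?case
  proof (rule exI[of _ "\<phi> \<circ> g"], intro conjI ballI allI impI)
    fix y assume y: "y \<in> ball x r \<inter> K"
    show "(\<phi> \<circ> g) y \<in> K" using \<phi>(1)[OF g_ball[OF y]] by simp
    show "(f ^^ Suc m) ((\<phi> \<circ> g) y) = y"
      using \<phi>(3)[OF g_ball[OF y]] g(1) y by (simp add: funpow_swap1)
    fix z assume z: "z \<in> ball x r \<inter> K"
    note yz = \<phi>(4)[OF g_ball[OF y] g_ball[OF z]]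
    have "dist ((\<phi> \<circ> g) y) ((\<phi> \<circ> g) z) \<le> \<mu> * (\<mu> ^ m * dist y z)"
      using yz mult_left_mono[OF g'(1)[OF y z], of \<mu>] \<mu> by (auto intro: order_trans)
    thus *: "dist ((\<phi> \<circ> g) y) ((\<phi> \<circ> g) z) \<le> \<mu> ^ Suc m * dist y z"
      by (simp add: mult.assoc)
    fix i assume i: "i \<le> Suc m"
    show "dist ((f ^^ i) ((\<phi> \<circ> g) y)) ((f ^^ i) ((\<phi> \<circ> g) z)) \<le> dist y z"
    proof (cases i)
      case 0
      have "\<mu> ^ Suc m * dist y z \<le> 1 * dist y z"
        using \<mu> by (intro mult_right_mono power_le_one) auto
      with * 0 show ?thesis by simp
    next
      case (Suc j)
      thus ?thesis using g'(2)[OF y z, of j] i \<phi>(3)[OF g_ball[OF y]] \<phi>(3)[OF g_ball[OF z]]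
        by (simp add: funpow_swap1)
    qed
  qed (use g(2) \<phi>(2) in simp)
qed

definition expansivity_const :: real where
  "expansivity_const = min r c / 2"

lemma expansivity_const_pos: "expansivity_const > 0"
  using r c by (simp add: expansivity_const_def)

text \<open>
  The branch through \<open>x\<close> takes \<open>f y\<close> to a preimage of \<open>f y\<close> that is close to \<open>x\<close>, hence
  to \<open>y\<close>; the gap between points of a fibre forces it to be \<open>y\<close>, so the contraction of the
  branch bounds the distance of \<open>x\<close> and \<open>y\<close>.
\<close>
lemma local_expansion:
  assumes x: "x \<in> K" and y: "y \<in> K"
    and xy: "dist x y \<le> expansivity_const" "dist (f x) (f y) \<le> expansivity_const"
  shows "dist x y \<le> \<mu> * dist (f x) (f y)"
proof -
  have e: "expansivity_const < r" "2 * expansivity_const \<le> c"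
    using r c by (auto simp: expansivity_const_def min_def)
  from branch[OF x, unfolded Pi_iff] obtain \<phi> where
    \<phi>: "\<And>y. y \<in> ball (f x) r \<inter> K \<Longrightarrow> \<phi> y \<in> K" "\<phi> (f x) = x"
      "\<And>y. y \<in> ball (f x) r \<inter> K \<Longrightarrow> f (\<phi> y) = y"
      "\<And>y z. y \<in> ball (f x) r \<inter> K \<Longrightarrow> z \<in> ball (f x) r \<inter> K \<Longrightarrow> dist (\<phi> y) (\<phi> z) \<le> \<mu> * dist y z"
    by metis
  have fx: "f x \<in> ball (f x) r \<inter> K" using r invariant[OF x] by simp
  have fy: "f y \<in> ball (f x) r \<inter> K" using xy(2) e(1) invariant[OF y] by simp
  have d: "dist x (\<phi> (f y)) \<le> \<mu> * dist (f x) (f y)"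
    using \<phi>(4)[OF fx fy] \<phi>(2) by simp
  also have "\<dots> \<le> 1 * dist (f x) (f y)"
    using \<mu> by (intro mult_right_mono) auto
  finally have "dist x (\<phi> (f y)) \<le> expansivity_const" using xy(2) by simp
  hence "dist (\<phi> (f y)) y \<le> c"
    using xy(1) e(2) dist_triangle3[of "\<phi> (f y)" y x] by simp
  hence "\<phi> (f y) = y" using fibre_gap[OF \<phi>(1)[OF fy] y] \<phi>(3)[OF fy] by force
  with d show ?thesis by simp
qed

lemma periodic_points_expansive:
  assumes n: "n \<ge> 1" and p: "p \<in> Fix K f n" and q: "q \<in> Fix K f n"
    and close: "\<And>i. i < n \<Longrightarrow> dist ((f ^^ i) p) ((f ^^ i) q) \<le> expansivity_const"
  shows "p = q"
proof -
  have K: "p \<in> K" "q \<in> K" and period: "(f ^^ n) p = p" "(f ^^ n) q = q"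
    using p q by (auto simp: Fix_def)
  have close': "dist ((f ^^ i) p) ((f ^^ i) q) \<le> expansivity_const" if "i \<le> n" for i
    using that close[of i] close[of 0] n period by (cases "i = n") auto
  have "dist p q \<le> \<mu> ^ i * dist ((f ^^ i) p) ((f ^^ i) q)" if "i \<le> n" for i
    using that
  proof (induction i)
    case (Suc i)
    have "dist ((f ^^ i) p) ((f ^^ i) q) \<le> \<mu> * dist ((f ^^ Suc i) p) ((f ^^ Suc i) q)"
      using local_expansion[OF iterate_invariant[OF K(1)] iterate_invariant[OF K(2)], of i i]
        close'[of i] close'[of "Suc i"] Suc.prems by simp
    hence "\<mu> ^ i * dist ((f ^^ i) p) ((f ^^ i) q)
        \<le> \<mu> ^ i * (\<mu> * dist ((f ^^ Suc i) p) ((f ^^ Suc i) q))"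
      using \<mu> by (intro mult_left_mono) auto
    with Suc show ?case by (simp add: mult_ac)
  qed simp
  from this[of n] have *: "dist p q \<le> \<mu> ^ n * dist p q" by (simp add: period)
  have "\<mu> ^ n < 1" using \<mu> n by (simp add: power_less_one_iff)
  hence "dist p q > 0 \<Longrightarrow> \<mu> ^ n * dist p q < 1 * dist p q"
    by (intro mult_strict_right_mono) auto
  with * show ?thesis using zero_less_dist_iff[of p q] by fastforce
qed

text \<open>
  An accumulation point of \<open>Fix n\<close> would have two of its points so close to it that their orbits
  stay \<open>expansivity_const\<close>-close for \<open>n\<close> steps.
\<close>
lemma finite_Fix:
  assumes n: "n \<ge> 1"
  shows "finite (Fix K f n)"
proof -
  have "\<not> z islimpt Fix K f n" if z: "z \<in> K" for z
  proof
    assume lim: "z islimpt Fix K f n"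
    have "\<forall>i\<in>{..<n}. eventually (\<lambda>y. dist ((f ^^ i) y) ((f ^^ i) z) < expansivity_const / 2)
        (at z within K)"
    proof
      fix i
      have "((f ^^ i) \<longlongrightarrow> (f ^^ i) z) (at z within K)"
        using continuous_on_iterate z by (simp add: continuous_on_def)
      thus "eventually (\<lambda>y. dist ((f ^^ i) y) ((f ^^ i) z) < expansivity_const / 2)
          (at z within K)"
        by (rule tendstoD) (use expansivity_const_pos in simp)
    qed
    hence "eventually (\<lambda>y. \<forall>i\<in>{..<n}. dist ((f ^^ i) y) ((f ^^ i) z) < expansivity_const / 2)
        (at z within K)"
      by (intro eventually_ball_finite) auto
    then obtain d where d: "d > 0" and near: "\<And>y i. y \<in> K \<Longrightarrow> y \<noteq> z \<Longrightarrow> dist y z < d \<Longrightarrow> i < n \<Longrightarrow>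
        dist ((f ^^ i) y) ((f ^^ i) z) < expansivity_const / 2"
      unfolding eventually_at by auto
    have "infinite (Fix K f n \<inter> ball z d)"
      using lim d by (simp add: islimpt_eq_infinite_ball)
    hence "infinite (Fix K f n \<inter> ball z d - {z})" by simp
    then obtain p where p: "p \<in> Fix K f n \<inter> ball z d - {z}"
      by (metis finite.emptyI equals0I)
    have "infinite (Fix K f n \<inter> ball z d - {z} - {p})"
      using \<open>infinite (Fix K f n \<inter> ball z d - {z})\<close> by simp
    then obtain q where q: "q \<in> Fix K f n \<inter> ball z d - {z} - {p}"
      by (metis finite.emptyI equals0I)
    have "p = q"
    proof (rule periodic_points_expansive[OF n])
      fix i assume "i < n"
      with p q near[of p i] near[of q i]
      have "dist ((f ^^ i) p) ((f ^^ i) z) < expansivity_const / 2"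
        "dist ((f ^^ i) q) ((f ^^ i) z) < expansivity_const / 2"
        by (auto simp: Fix_def dist_commute)
      thus "dist ((f ^^ i) p) ((f ^^ i) q) \<le> expansivity_const"
        using dist_triangle2[of "(f ^^ i) p" "(f ^^ i) q" "(f ^^ i) z"] by simp
    qed (use p q in auto)
    with q show False by simp
  qed
  hence "finite (K \<inter> Fix K f n)" by (rule finite_not_islimpt_in_compact[OF compact])
  moreover have "K \<inter> Fix K f n = Fix K f n" by (auto simp: Fix_def)
  ultimately show ?thesis by simp
qed

end

section \<open>Shadowing by periodic points\<close>

locale exact_expanding_map = expanding_map +
  assumes onto: "f ` K = K"
    and exact: "openin (top_of_set K) V \<Longrightarrow> V \<noteq> {} \<Longrightarrow> \<exists>N\<ge>1. (f ^^ N) ` V = K"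
begin

lemma iterate_onto: "(f ^^ n) ` K = K"
proof (induction n)
  case (Suc n)
  have "(f ^^ Suc n) ` K = f ` ((f ^^ n) ` K)" by (simp add: image_comp comp_def)
  thus ?case using Suc onto by simp
qed simp

text \<open>
  Once an iterate maps a set onto \<open>K\<close>, so do all later iterates, because \<open>f\<close> is onto. The
  exactness times of finitely many balls of half the radius can therefore be replaced by a common
  one.
\<close>
lemma uniformly_exact:
  assumes \<delta>: "\<delta> > 0"
  obtains M where "M \<ge> 1" "\<And>x y. x \<in> K \<Longrightarrow> y \<in> K \<Longrightarrow> \<exists>z\<in>ball x \<delta> \<inter> K. (f ^^ M) z = y"
proof -
  have "\<exists>N. (f ^^ N) ` (ball x (\<delta> / 2) \<inter> K) = K" if "x \<in> K" for x
  proof -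
    have "openin (top_of_set K) (ball x (\<delta> / 2) \<inter> K)"
      using openin_open_Int[OF open_ball, of K x "\<delta> / 2"] by (simp add: Int_commute)
    moreover have "x \<in> ball x (\<delta> / 2) \<inter> K" using that \<delta> by simp
    ultimately show ?thesis using exact by blast
  qed
  then obtain N where N: "\<And>x. x \<in> K \<Longrightarrow> (f ^^ N x) ` (ball x (\<delta> / 2) \<inter> K) = K" by metis
  obtain C where C: "C \<subseteq> K" "finite C" "K \<subseteq> (\<Union>x\<in>C. ball x (\<delta> / 2))"
    by (rule compactE_image[OF compact, of K "\<lambda>x. ball x (\<delta> / 2)"]) (use \<delta> in auto)
  define M where "M = Suc (\<Sum>x\<in>C. N x)"
  show ?thesis
  proof (rule that[of M])
    fix x y assume x: "x \<in> K" and y: "y \<in> K"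
    then obtain u where u: "u \<in> C" "x \<in> ball u (\<delta> / 2)" using C(3) by auto
    have "N u \<le> M" unfolding M_def using member_le_sum[OF u(1), of N] C(2) by simp
    hence "(f ^^ M) ` (ball u (\<delta> / 2) \<inter> K)
        = (f ^^ (M - N u)) ` ((f ^^ N u) ` (ball u (\<delta> / 2) \<inter> K))"
      by (simp add: image_comp funpow_add[symmetric])
    also have "\<dots> = K" using u(1) C(1) by (simp only: N subsetD iterate_onto)
    finally have "y \<in> (f ^^ M) ` (ball u (\<delta> / 2) \<inter> K)" using y by simp
    then obtain z where z: "z \<in> ball u (\<delta> / 2) \<inter> K" "(f ^^ M) z = y" by blast
    have "dist x z < \<delta>"
      using u(2) z(1) dist_triangle3[of x z u] by simp
    with z show "\<exists>z\<in>ball x \<delta> \<inter> K. (f ^^ M) z = y" by auto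
  qed (simp add: M_def)
qed

text \<open>
  A point \<open>z\<close> near \<open>f\<^sup>n x\<close> with \<open>f\<^sup>M z = x\<close> closes the orbit segment of \<open>x\<close> up. Pulling \<open>z\<close> back
  along the segment gives \<open>w\<close> near \<open>x\<close> with \<open>f\<^bsup>n + M\<^esup> w = x\<close>, and the branch \<open>g\<close> of the inverse of
  \<open>f\<^bsup>n + M\<^esup>\<close> through \<open>w\<close> maps a ball around \<open>x\<close> into itself. Its fixed point is the desired
  periodic point.
\<close>
lemma periodic_shadowing:
  assumes \<epsilon>: "\<epsilon> > 0"
  shows "\<exists>M\<ge>1. \<exists>q. \<forall>n. \<forall>x\<in>K. q n x \<in> Fix K f (n + M) \<and>
    (\<forall>i\<le>n. dist ((f ^^ i) (q n x)) ((f ^^ i) x) \<le> \<epsilon>)"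
proof -
  define s where "s = min r \<epsilon> / 2"
  have s: "0 < s" "s < r" "2 * s \<le> \<epsilon>" using r \<epsilon> by (auto simp: s_def min_def)
  \<comment> \<open>With this radius, \<open>\<delta> + \<mu> s = s\<close>: the contracted and displaced ball fits in the original.\<close>
  define \<delta> where "\<delta> = (1 - \<mu>) * s"
  have \<delta>: "0 < \<delta>" "\<delta> \<le> s" using s(1) \<mu> by (auto simp: \<delta>_def mult_le_cancel_right1)
  obtain M where M: "M \<ge> 1" "\<And>x y. x \<in> K \<Longrightarrow> y \<in> K \<Longrightarrow> \<exists>z\<in>ball x \<delta> \<inter> K. (f ^^ M) z = y"
    by (rule uniformly_exact[OF \<delta>(1)]) (rule that)
  have "\<exists>p\<in>Fix K f (n + M). \<forall>i\<le>n. dist ((f ^^ i) p) ((f ^^ i) x) \<le> \<epsilon>" if x: "x \<in> K" for n x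
  proof -
    have fnx: "(f ^^ n) x \<in> K" by (rule iterate_invariant[OF x])
    from M(2)[OF fnx x] obtain z where
      z: "z \<in> ball ((f ^^ n) x) \<delta>" "z \<in> K" "(f ^^ M) z = x" by auto
    from iterated_inverse_branch[OF x refl, of n] obtain \<psi> where
      \<psi>: "\<And>y. y \<in> ball ((f ^^ n) x) r \<inter> K \<Longrightarrow> \<psi> y \<in> K \<and> (f ^^ n) (\<psi> y) = y"
        "\<psi> ((f ^^ n) x) = x"
        "\<And>y z i. y \<in> ball ((f ^^ n) x) r \<inter> K \<Longrightarrow> z \<in> ball ((f ^^ n) x) r \<inter> K \<Longrightarrow> i \<le> n \<Longrightarrow>
          dist ((f ^^ i) (\<psi> y)) ((f ^^ i) (\<psi> z)) \<le> dist y z"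
      by metis
    define w where "w = \<psi> z"
    have z': "z \<in> ball ((f ^^ n) x) r \<inter> K" using z \<delta>(2) s(2) by simp
    have w: "w \<in> K" "(f ^^ n) w = z" using \<psi>(1)[OF z'] by (auto simp: w_def)
    have w_close: "dist ((f ^^ i) w) ((f ^^ i) x) \<le> \<delta>" if "i \<le> n" for i
      using \<psi>(3)[OF z' _ that, of "(f ^^ n) x"] \<psi>(2) fnx r z(1)
      by (simp add: w_def dist_commute)
    have "(f ^^ (n + M)) w = x"
      using w(2) z(3) by (simp add: funpow_add add.commute[of n])
    from iterated_inverse_branch[OF w(1) this] obtain g where
      g: "\<And>y. y \<in> ball x r \<inter> K \<Longrightarrow> g y \<in> K \<and> (f ^^ (n + M)) (g y) = y" "g x = w"
        "\<And>y z. y \<in> ball x r \<inter> K \<Longrightarrow> z \<in> ball x r \<inter> K \<Longrightarrow>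
          dist (g y) (g z) \<le> \<mu> ^ (n + M) * dist y z"
        "\<And>y z i. y \<in> ball x r \<inter> K \<Longrightarrow> z \<in> ball x r \<inter> K \<Longrightarrow> i \<le> n + M \<Longrightarrow>
          dist ((f ^^ i) (g y)) ((f ^^ i) (g z)) \<le> dist y z"
      by metis
    define T where "T = cball x s \<inter> K"
    have T: "T \<subseteq> ball x r \<inter> K" "x \<in> T" using s x by (auto simp: T_def)
    have contraction: "dist (g y) (g z) \<le> \<mu> * dist y z" if "y \<in> T" "z \<in> T" for y z
    proof -
      have "\<mu> ^ (n + M) \<le> \<mu> ^ 1" using \<mu> M(1) by (intro power_decreasing) auto
      hence "\<mu> ^ (n + M) * dist y z \<le> \<mu> * dist y z" by (intro mult_right_mono) auto
      with g(3)[of y z] that T(1) show ?thesis by force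
    qed
    have into: "g ` T \<subseteq> T"
    proof (rule image_subsetI)
      fix y assume y: "y \<in> T"
      have "dist x (g y) \<le> dist x w + dist (g x) (g y)"
        using dist_triangle[of x "g y" w] g(2) by simp
      also have "\<dots> \<le> \<delta> + \<mu> * dist x y"
        using w_close[of 0] contraction[OF T(2) y] by (simp add: dist_commute)
      also have "\<dots> \<le> \<delta> + \<mu> * s" using y \<mu> by (auto simp: T_def)
      also have "\<dots> = s" by (simp add: \<delta>_def algebra_simps)
      finally show "g y \<in> T" using g(1)[of y] y T(1) by (auto simp: T_def)
    qed
    have "compact T" unfolding T_def by (intro closed_Int_compact compact closed_cball)
    hence "complete T" by (rule compact_imp_complete)
    hence "\<exists>!p. p \<in> T \<and> g p = p"
      by (rule Banach_fix[where c = \<mu>]) (use T(2) \<mu> into contraction in auto)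
    then obtain p where p: "p \<in> T" "g p = p" by auto
    have "p \<in> ball x r \<inter> K" using p(1) T(1) by blast
    hence p_fix: "p \<in> Fix K f (n + M)" using g(1)[of p] p(2) by (simp add: Fix_def)
    have "dist ((f ^^ i) p) ((f ^^ i) x) \<le> \<epsilon>" if i: "i \<le> n" for i
    proof -
      have "dist ((f ^^ i) p) ((f ^^ i) w) \<le> dist p x"
        using g(4)[of p x i] p T g(2) i by (metis subsetD trans_le_add1)
      moreover have "dist p x \<le> s" using p(1) by (simp add: T_def dist_commute)
      ultimately have "dist ((f ^^ i) p) ((f ^^ i) x) \<le> s + \<delta>"
        using w_close[OF i] dist_triangle[of "(f ^^ i) p" "(f ^^ i) x" "(f ^^ i) w"] by linarith
      thus ?thesis using \<delta>(2) s(3) by linarith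
    qed
    with p_fix show ?thesis by auto
  qed
  hence "\<forall>n. \<forall>x\<in>K. \<exists>p. p \<in> Fix K f (n + M) \<and> (\<forall>i\<le>n. dist ((f ^^ i) p) ((f ^^ i) x) \<le> \<epsilon>)"
    by blast
  then obtain q where "\<forall>n. \<forall>x\<in>K.
      q n x \<in> Fix K f (n + M) \<and> (\<forall>i\<le>n. dist ((f ^^ i) (q n x)) ((f ^^ i) x) \<le> \<epsilon>)"
    unfolding bchoice_iff choice_iff by blast
  with M(1) show ?thesis by blast
qed

section \<open>Counting periodic points and separated points\<close>

text \<open>
  The two pieces of a periodic orbit of length \<open>n + m\<close> are shadowed separately; the pair of
  shadowing points determines the orbit by expansivity.
\<close>
lemma card_Fix_submultiplicative:
  obtains M where "M \<ge> 1" "\<And>n m. n \<ge> 1 \<Longrightarrow> m \<ge> 1 \<Longrightarrow>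
    card (Fix K f (n + m)) \<le> card (Fix K f (n + M)) * card (Fix K f (m + M))"
proof -
  have half: "expansivity_const / 2 > 0" using expansivity_const_pos by simp
  obtain M q where M: "M \<ge> 1" and q: "\<And>n x. x \<in> K \<Longrightarrow> q n x \<in> Fix K f (n + M)"
      "\<And>n x i. x \<in> K \<Longrightarrow> i \<le> n \<Longrightarrow> dist ((f ^^ i) (q n x)) ((f ^^ i) x) \<le> expansivity_const / 2"
    using periodic_shadowing[OF half] by blast
  have same_shadow: "dist ((f ^^ i) x) ((f ^^ i) y) \<le> expansivity_const"
    if "x \<in> K" "y \<in> K" "q n x = q n y" "i \<le> n" for x y n i
    using q(2)[OF that(1,4)] q(2)[OF that(2,4)] that(3)
      dist_triangle3[of "(f ^^ i) x" "(f ^^ i) y" "(f ^^ i) (q n x)"] by simp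
  show ?thesis
  proof (rule that[OF M])
    fix n m :: nat assume n: "n \<ge> 1" and m: "m \<ge> 1"
    define code where "code = (\<lambda>p. (q n p, q m ((f ^^ n) p)))"
    have "inj_on code (Fix K f (n + m))"
    proof (rule inj_onI)
      fix x y assume xy: "x \<in> Fix K f (n + m)" "y \<in> Fix K f (n + m)" and "code x = code y"
      hence eq: "q n x = q n y" "q m ((f ^^ n) x) = q m ((f ^^ n) y)" by (auto simp: code_def)
      have K: "x \<in> K" "y \<in> K" using xy by (auto simp: Fix_def)
      show "x = y"
      proof (rule periodic_points_expansive[OF _ xy])
        fix i assume i: "i < n + m"
        show "dist ((f ^^ i) x) ((f ^^ i) y) \<le> expansivity_const"
        proof (cases "i \<le> n")
          case True
          thus ?thesis by (rule same_shadow[OF K eq(1)])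
        next
          case False
          hence "(f ^^ i) u = (f ^^ (i - n)) ((f ^^ n) u)" for u
            by (simp add: funpow_add[symmetric, THEN fun_cong, unfolded comp_def])
          moreover have "i - n \<le> m" using i by simp
          ultimately show ?thesis
            using same_shadow[OF iterate_invariant[OF K(1)] iterate_invariant[OF K(2)] eq(2)]
            by simp
        qed
      qed (use n in simp)
    qed
    moreover have "code ` Fix K f (n + m) \<subseteq> Fix K f (n + M) \<times> Fix K f (m + M)"
      using q(1) iterate_invariant by (auto simp: code_def Fix_def)
    moreover have "finite (Fix K f (n + M) \<times> Fix K f (m + M))"
      using finite_Fix n m by simp
    ultimately have "card (Fix K f (n + m)) \<le> card (Fix K f (n + M) \<times> Fix K f (m + M))"
      by (rule card_inj_on_le)
    thus "card (Fix K f (n + m)) \<le> card (Fix K f (n + M)) * card (Fix K f (m + M))"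
      by (simp add: card_cartesian_product)
  qed
qed

lemma bowen_dist_le_iff:
  assumes "n \<ge> 1"
  shows "bowen_dist g n x y \<le> \<epsilon> \<longleftrightarrow> (\<forall>i<n. dist ((g ^^ i) x) ((g ^^ i) y) \<le> \<epsilon>)"
proof -
  have "{..<n} \<noteq> {}" using assms by (simp add: lessThan_empty_iff)
  thus ?thesis unfolding bowen_dist_def by (subst Max_le_iff) auto
qed

text \<open>
  Points that are \<open>(n, \<epsilon>)\<close>-separated are \<open>\<epsilon>/2\<close>-shadowed by distinct points of \<open>Fix (n + M)\<close>.
\<close>
lemma card_separated_le:
  assumes \<epsilon>: "\<epsilon> > 0"
  obtains M where "M \<ge> 1"
    "\<And>n E. n \<ge> 1 \<Longrightarrow> separated_set K f n \<epsilon> E \<Longrightarrow> card E \<le> card (Fix K f (n + M))"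
proof -
  have half: "\<epsilon> / 2 > 0" using \<epsilon> by simp
  obtain M q where M: "M \<ge> 1" and q: "\<And>n x. x \<in> K \<Longrightarrow> q n x \<in> Fix K f (n + M)"
      "\<And>n x i. x \<in> K \<Longrightarrow> i \<le> n \<Longrightarrow> dist ((f ^^ i) (q n x)) ((f ^^ i) x) \<le> \<epsilon> / 2"
    using periodic_shadowing[OF half] by blast
  show ?thesis
  proof (rule that[OF M])
    fix n E assume n: "n \<ge> (1::nat)" and E: "separated_set K f n \<epsilon> E"
    have "inj_on (q n) E"
    proof (rule inj_onI)
      fix x y assume xy: "x \<in> E" "y \<in> E" "q n x = q n y"
      have K: "x \<in> K" "y \<in> K" using E xy by (auto simp: separated_set_def)
      have "dist ((f ^^ i) x) ((f ^^ i) y) \<le> \<epsilon>" if "i < n" for i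
        using q(2)[OF K(1), of i n] q(2)[OF K(2), of i n] that xy(3)
          dist_triangle3[of "(f ^^ i) x" "(f ^^ i) y" "(f ^^ i) (q n x)"] by simp
      hence "bowen_dist f n x y \<le> \<epsilon>" using n by (simp add: bowen_dist_le_iff)
      with E xy show "x = y" by (simp add: separated_set_def)
    qed
    moreover have "q n ` E \<subseteq> Fix K f (n + M)" using q(1) E by (auto simp: separated_set_def)
    ultimately show "card E \<le> card (Fix K f (n + M))"
      by (rule card_inj_on_le) (use finite_Fix n in simp)
  qed
qed

text \<open>
  The lower bound holds because \<open>Fix n\<close> is itself \<open>(n, \<epsilon>)\<close>-separated, by expansivity. The upper
  bound is uniform over all separated sets, so the maximum of their cardinalities is attained.
\<close>
lemma max_separated_between:
  assumes \<epsilon>: "0 < \<epsilon>" "\<epsilon> \<le> expansivity_const"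
  obtains M where "M \<ge> 1"
    "\<And>n. n \<ge> 1 \<Longrightarrow> card (Fix K f n) \<le> max_separated K f n \<epsilon>"
    "\<And>n. n \<ge> 1 \<Longrightarrow> max_separated K f n \<epsilon> \<le> card (Fix K f (n + M))"
proof -
  obtain M where M: "M \<ge> 1"
    "\<And>n E. n \<ge> 1 \<Longrightarrow> separated_set K f n \<epsilon> E \<Longrightarrow> card E \<le> card (Fix K f (n + M))"
    by (rule card_separated_le[OF \<epsilon>(1)]) (rule that)
  have Fix_separated: "separated_set K f n \<epsilon> (Fix K f n)" if n: "n \<ge> 1" for n
  proof -
    have "x = y" if "x \<in> Fix K f n" "y \<in> Fix K f n" "bowen_dist f n x y \<le> \<epsilon>" for x y
      by (rule periodic_points_expansive[OF n that(1,2)])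
        (use that(3) \<epsilon>(2) n in \<open>auto simp: bowen_dist_le_iff intro: order_trans\<close>)
    thus ?thesis by (auto simp: separated_set_def Fix_def)
  qed
  show ?thesis
  proof (rule that[OF M(1)])
    fix n :: nat assume n: "n \<ge> 1"
    let ?S = "{card E | E. separated_set K f n \<epsilon> E}"
    have "?S \<subseteq> {..card (Fix K f (n + M))}" using M(2)[OF n] by auto
    hence fin: "finite ?S" by (rule finite_subset) simp
    show "card (Fix K f n) \<le> max_separated K f n \<epsilon>"
      unfolding max_separated_def by (rule Max_ge[OF fin]) (use Fix_separated[OF n] in auto)
    show "max_separated K f n \<epsilon> \<le> card (Fix K f (n + M))"
      unfolding max_separated_def using Fix_separated[OF n] M(2)[OF n]
      by (subst Max_le_iff[OF fin]) auto
  qed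
qed

section \<open>Entropy as the growth rate of periodic points\<close>

lemma eventually_Fix_nonempty:
  assumes "K \<noteq> {}"
  shows "eventually (\<lambda>n. card (Fix K f n) \<ge> 1) sequentially"
proof -
  obtain M q where M: "M \<ge> 1" "\<And>n x. x \<in> K \<Longrightarrow> q n x \<in> Fix K f (n + M)"
    using periodic_shadowing[OF zero_less_one] by blast
  have "card (Fix K f n) \<ge> 1" if "n \<ge> M" for n
  proof -
    have "Fix K f n \<noteq> {}" using M(2)[of _ "n - M"] assms that by force
    moreover have "finite (Fix K f n)" using finite_Fix M(1) that by simp
    ultimately show ?thesis by (simp add: Suc_le_eq card_gt_0_iff)
  qed
  thus ?thesis by (auto simp: eventually_sequentially)
qed

lemma card_Fix_rate_convergent: "convergent (\<lambda>n. ln (real (card (Fix K f n))) / real n)"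
proof -
  obtain M where M: "M \<ge> 1" "\<And>n m. n \<ge> 1 \<Longrightarrow> m \<ge> 1 \<Longrightarrow>
      card (Fix K f (n + m)) \<le> card (Fix K f (n + M)) * card (Fix K f (m + M))"
    by (rule card_Fix_submultiplicative) (rule that)
  have nonneg: "ln (real k) \<ge> 0" for k :: nat by (cases k) auto
  show ?thesis
  proof (rule fekete_shifted[OF _ nonneg M(1)])
    fix n m :: nat assume nm: "n \<ge> 1" "m \<ge> 1"
    let ?N = "\<lambda>n. card (Fix K f n)"
    show "ln (real (?N (n + m))) \<le> ln (real (?N (n + M))) + ln (real (?N (m + M)))"
    proof (cases "?N (n + m) = 0")
      \<comment> \<open>Here the left-hand side is \<open>0\<close>, by the convention \<open>ln 0 = 0\<close>.\<close>
      case True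
      thus ?thesis using nonneg[of "?N (n + M)"] nonneg[of "?N (m + M)"] by simp
    next
      case False
      hence pos: "?N (n + M) > 0" "?N (m + M) > 0" using M(2)[OF nm] by (auto intro: gr0I)
      have "ln (real (?N (n + m))) \<le> ln (real (?N (n + M) * ?N (m + M)))"
        using False M(2)[OF nm] by (subst ln_le_cancel_iff) (use pos in \<open>auto simp del: of_nat_mult\<close>)
      also have "\<dots> = ln (real (?N (n + M))) + ln (real (?N (m + M)))"
        using pos by (simp add: ln_mult)
      finally show ?thesis .
    qed
  qed
qed

lemma log_card_rate:
  "m \<ge> 1 \<Longrightarrow> n \<ge> 1 \<Longrightarrow> log_card m / ereal (real n) = ereal (ln (real m) / real n)"
  by (simp add: log_card_def)

lemma max_separated_rate_tendsto:
  assumes K: "K \<noteq> {}" and \<epsilon>: "0 < \<epsilon>" "\<epsilon> \<le> expansivity_const"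
    and L: "(\<lambda>n. ln (real (card (Fix K f n))) / real n) \<longlonglongrightarrow> L"
  shows "(\<lambda>n. log_card (max_separated K f n \<epsilon>) / ereal (real n)) \<longlonglongrightarrow> ereal L"
proof -
  obtain M where M: "M \<ge> 1"
    "\<And>n. n \<ge> 1 \<Longrightarrow> card (Fix K f n) \<le> max_separated K f n \<epsilon>"
    "\<And>n. n \<ge> 1 \<Longrightarrow> max_separated K f n \<epsilon> \<le> card (Fix K f (n + M))"
    by (rule max_separated_between[OF \<epsilon>]) (rule that)
  note ev = eventually_conj[OF eventually_Fix_nonempty[OF K] eventually_ge_at_top[of 1]]
  have "(\<lambda>n. ln (real (max_separated K f n \<epsilon>)) / real n) \<longlonglongrightarrow> L"
  proof (rule tendsto_sandwich[OF _ _ L tendsto_shifted_rate[OF L, of M]])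
    show "eventually (\<lambda>n. ln (real (card (Fix K f n))) / real n
        \<le> ln (real (max_separated K f n \<epsilon>)) / real n) sequentially"
      using ev
    proof eventually_elim
      case (elim n)
      with M(2)[of n] show ?case by (intro divide_right_mono) auto
    qed
    show "eventually (\<lambda>n. ln (real (max_separated K f n \<epsilon>)) / real n
        \<le> ln (real (card (Fix K f (n + M)))) / real n) sequentially"
      using ev
    proof eventually_elim
      case (elim n)
      with M(2)[of n] M(3)[of n] show ?case by (intro divide_right_mono) auto
    qed
  qed
  hence "(\<lambda>n. ereal (ln (real (max_separated K f n \<epsilon>)) / real n)) \<longlonglongrightarrow> ereal L" by simp
  moreover have "eventually (\<lambda>n. ereal (ln (real (max_separated K f n \<epsilon>)) / real n)
      = log_card (max_separated K f n \<epsilon>) / ereal (real n)) sequentially"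
    using ev
  proof eventually_elim
    case (elim n)
    with M(2)[of n] show ?case by (intro log_card_rate[symmetric]) auto
  qed
  ultimately show ?thesis by (rule Lim_transform_eventually)
qed

text \<open>
  For \<open>\<epsilon>\<close> below the expansivity constant the upper growth rate of separated sets is independent
  of \<open>\<epsilon>\<close>, so the limit for \<open>\<epsilon> \<rightarrow> 0\<close> is that of an eventually constant function.
\<close>
lemma topological_entropy_eq_rate:
  assumes K: "K \<noteq> {}" and L: "(\<lambda>n. ln (real (card (Fix K f n))) / real n) \<longlonglongrightarrow> L"
  shows "topological_entropy K f = ereal L"
proof -
  define rate where
    "rate = (\<lambda>\<epsilon>. limsup (\<lambda>n. log_card (max_separated K f n \<epsilon>) / ereal (real n)))"
  have "rate \<epsilon> = ereal L" if "0 < \<epsilon>" "\<epsilon> < expansivity_const" for \<epsilon>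
    unfolding rate_def using max_separated_rate_tendsto[OF K _ _ L, of \<epsilon>] that
    by (intro lim_imp_Limsup) auto
  hence "eventually (\<lambda>\<epsilon>. rate \<epsilon> = ereal L) (at_right 0)"
    using expansivity_const_pos by (auto simp: eventually_at_right_field)
  hence "(rate \<longlongrightarrow> ereal L) (at_right 0)" by (rule tendsto_eventually)
  hence "Lim (at_right 0) rate = ereal L" by (intro tendsto_Lim) auto
  thus ?thesis by (simp add: topological_entropy_def rate_def)
qed

end

theorem theorem1p2:
  fixes K :: "'a::metric_space set" and f :: "'a \<Rightarrow> 'a"
  assumes "compact K" and "K \<noteq> {}"
    and "ruelle_expanding K f"
    and "basic_component K f"
  shows "(\<lambda>n. log_card (num_periodic K f n) / ereal (real n))
           \<longlonglongrightarrow> topological_entropy K f"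
proof -
  from assms(3) obtain r \<mu> c where fK: "f \<in> K \<rightarrow> K" and cont: "continuous_on K f"
    and pos: "0 < r" "0 < \<mu>" "\<mu> < 1" "0 < c"
    and gap: "\<forall>x\<in>K. \<forall>y\<in>K. x \<noteq> y \<and> f x = f y \<longrightarrow> dist x y > c"
    and branch: "\<forall>x\<in>K. \<forall>a\<in>K. f a = x \<longrightarrow>
         (\<exists>\<phi>. \<phi> \<in> ball x r \<inter> K \<rightarrow> K \<and> \<phi> x = a \<and>
           (\<forall>y\<in>ball x r \<inter> K. f (\<phi> y) = y) \<and>
           (\<forall>y\<in>ball x r \<inter> K. \<forall>z\<in>ball x r \<inter> K. dist (\<phi> y) (\<phi> z) \<le> \<mu> * dist y z))"
    unfolding ruelle_expanding_def by (elim conjE exE) (rule that)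
  have onto: "f ` K = K"
    using assms(4) unfolding basic_component_def by (rule conjunct1)
  have "\<forall>V. openin (top_of_set K) V \<and> V \<noteq> {} \<longrightarrow> (\<exists>N\<ge>1. (f ^^ N) ` V = K)"
    using assms(4) unfolding basic_component_def by (elim conjE)
  hence exact: "\<exists>N\<ge>1. (f ^^ N) ` V = K" if "openin (top_of_set K) V" "V \<noteq> {}" for V
    using that by blast
  interpret exact_expanding_map K f r \<mu> c
  proof unfold_locales
    fix a assume a: "a \<in> K"
    hence "f a \<in> K" using fK by auto
    with a branch show "\<exists>\<phi>. \<phi> \<in> ball (f a) r \<inter> K \<rightarrow> K \<and> \<phi> (f a) = a \<and>
           (\<forall>y\<in>ball (f a) r \<inter> K. f (\<phi> y) = y) \<and>
           (\<forall>y\<in>ball (f a) r \<inter> K. \<forall>z\<in>ball (f a) r \<inter> K. dist (\<phi> y) (\<phi> z) \<le> \<mu> * dist y z)"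
      by blast
  next
    fix x assume "x \<in> K"
    thus "f x \<in> K" using fK by blast
  next
    fix x y assume "x \<in> K" "y \<in> K" "x \<noteq> y" "f x = f y"
    thus "dist x y > c" using gap by blast
  qed (fact assms(1) cont pos onto exact)+
  obtain L where L: "(\<lambda>n. ln (real (card (Fix K f n))) / real n) \<longlonglongrightarrow> L"
    using card_Fix_rate_convergent by (auto simp: convergent_def)
  hence "(\<lambda>n. ereal (ln (real (card (Fix K f n))) / real n)) \<longlonglongrightarrow> ereal L" by simp
  moreover have "eventually (\<lambda>n. ereal (ln (real (card (Fix K f n))) / real n)
      = log_card (num_periodic K f n) / ereal (real n)) sequentially"
    using eventually_Fix_nonempty[OF assms(2)] eventually_ge_at_top[of 1]
  proof eventually_elim
    case (elim n)
    thus ?case using log_card_rate[OF elim] by (simp add: num_periodic_def Fix_def)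
  qed
  ultimately show ?thesis
    unfolding topological_entropy_eq_rate[OF assms(2) L] by (rule Lim_transform_eventually)
qed

end
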